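(* Let $H$ and $K$ be arbitrary monoids and let $f \colon \mathcal P_{\mathrm{fin},1}(H) \to \mathcal P_{\mathrm{fin},1}(K)$ be an isomorphism. Then there is a (uniquely determined) bijection $g \colon H \to K$ such that $f(\{1_H, x\}) = \{1_K, g(x)\}$ for each $x \in H$. In particular, $g(1_H) = 1_K$.
   Context: Monoids are written multiplicatively; $1_H$ denotes the identity of a monoid $H$. Isomorphisms are semigroup isomorphisms. For a monoid $H$, $\mathcal P_{\mathrm{fin},1}(H)$ (the reduced finitary power monoid of $H$) is the monoid of all finite subsets of $H$ containing $1_H$, with the setwise product $XY = \{xy : x \in X,\, y \in Y\}$ and identity $\{1_H\}$. *)

theory Defs
  imports "HOL-Algebra.Coset"
begin

definition reduced_fin_power_monoid :: "('a, 'm) monoid_scheme \<Rightarrow> 'a set monoid"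
  where "reduced_fin_power_monoid H =
    \<lparr>carrier = {X. finite X \<and> X \<subseteq> carrier H \<and> \<one>\<^bsub>H\<^esub> \<in> X},
     mult = set_mult H,
     one = {\<one>\<^bsub>H\<^esub>}\<rparr>"

lemma monoid_reduced_fin_power_monoid:
  assumes "monoid H"
  shows "monoid (reduced_fin_power_monoid H)"
proof -
  interpret monoid H by fact
  show ?thesis
  proof (rule monoidI)
    fix X Y
    assume X: "X \<in> carrier (reduced_fin_power_monoid H)"
      and Y: "Y \<in> carrier (reduced_fin_power_monoid H)"
    have "\<exists>x\<in>X. \<exists>y\<in>Y. \<one>\<^bsub>H\<^esub> = x \<otimes>\<^bsub>H\<^esub> y"
      using X Y by (intro bexI[of _ "\<one>\<^bsub>H\<^esub>"]) (auto simp: reduced_fin_power_monoid_def)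
    then show "X \<otimes>\<^bsub>reduced_fin_power_monoid H\<^esub> Y \<in> carrier (reduced_fin_power_monoid H)"
      using X Y by (auto simp: reduced_fin_power_monoid_def set_mult_def)
  next
    fix X Y Z
    assume "X \<in> carrier (reduced_fin_power_monoid H)"
      "Y \<in> carrier (reduced_fin_power_monoid H)"
      "Z \<in> carrier (reduced_fin_power_monoid H)"
    then have c: "X \<subseteq> carrier H" "Y \<subseteq> carrier H" "Z \<subseteq> carrier H"
      by (auto simp: reduced_fin_power_monoid_def)
    have "(X <#>\<^bsub>H\<^esub> Y) <#>\<^bsub>H\<^esub> Z = (\<Union>x\<in>X. \<Union>y\<in>Y. \<Union>z\<in>Z. {x \<otimes>\<^bsub>H\<^esub> y \<otimes>\<^bsub>H\<^esub> z})"
      by (auto simp: set_mult_def)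
    also have "\<dots> = (\<Union>x\<in>X. \<Union>y\<in>Y. \<Union>z\<in>Z. {x \<otimes>\<^bsub>H\<^esub> (y \<otimes>\<^bsub>H\<^esub> z)})"
      using c by (intro SUP_cong refl) (auto simp: m_assoc subset_iff)
    also have "\<dots> = X <#>\<^bsub>H\<^esub> (Y <#>\<^bsub>H\<^esub> Z)"
      by (auto simp: set_mult_def)
    finally show "X \<otimes>\<^bsub>reduced_fin_power_monoid H\<^esub> Y \<otimes>\<^bsub>reduced_fin_power_monoid H\<^esub> Z =
        X \<otimes>\<^bsub>reduced_fin_power_monoid H\<^esub> (Y \<otimes>\<^bsub>reduced_fin_power_monoid H\<^esub> Z)"
      by (simp add: reduced_fin_power_monoid_def)
  qed (force simp: reduced_fin_power_monoid_def set_mult_def subset_iff)+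
qed

end

theory Submission imports Defs begin

text \<open>
  Write \<open>P(H)\<close> for the reduced finitary power monoid. A two-element set \<open>{1, x}\<close> must be
  recognised inside \<open>P(H)\<close> from the multiplication alone, and this is done by counting the
  solutions \<open>Y\<close> of equations \<open>U Y = V\<close>: an isomorphism preserves their number
  (\<open>card_left_solutions_iso\<close>). Let \<open>X = {1, x}\<close> and \<open>A = f X\<close>; the claim is that \<open>A\<close> has at most
  two elements. Since every factor contains the identity, powers form an increasing chain.

  If \<open>X\<^sup>4 = X\<^sup>3\<close>, let \<open>n\<close> be the step at which the chain of powers of \<open>X\<close> becomes
  stationary. It is the same for \<open>A\<close>, and both \<open>n\<close>-th powers are idempotent. For an idempotent
  \<open>E\<close> the solutions of \<open>E Y = E\<close> are precisely the subsets of \<open>E\<close> containing the identity, so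
  their number determines the cardinality of \<open>E\<close> (\<open>card_absorbed_by_idempotent\<close>). Hence \<open>A\<^sup>n\<close>
  has as many elements as \<open>X\<^sup>n = {1, x, \<dots>, x\<^sup>n}\<close>, that is, at most \<open>n + 1\<close>. As the chain
  of powers of \<open>A\<close> grows strictly up to step \<open>n\<close>, there is no room for a third element in \<open>A\<close>.

  If \<open>X\<^sup>4 \<noteq> X\<^sup>3\<close>, count the solutions of \<open>X Y = X\<^sup>3\<close>. Only \<open>{1, x\<^sup>2}\<close> and \<open>{1, x, x\<^sup>2}\<close>
  are possible (\<open>left_solutions_cube_pair\<close>). On the other side, \<open>A Y = A\<^sup>3\<close> is solved by
  \<open>Y = A\<^sup>2\<close>, and also by \<open>A\<^sup>2\<close> with any one non-identity element of \<open>A\<close> removed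
  (\<open>card_le_card_left_solutions_cube\<close>), which gives at least as many solutions as \<open>A\<close> has elements.

  So \<open>f {1, x} = {1, g x}\<close> for some \<open>g\<close>, and the same argument for the inverse of \<open>f\<close> makes
  \<open>g\<close> surjective.
\<close>

section \<open>Solutions of linear equations in a monoid\<close>

definition left_solutions :: "('a, 'm) monoid_scheme \<Rightarrow> 'a \<Rightarrow> 'a \<Rightarrow> 'a set"
  where "left_solutions G a b = {y \<in> carrier G. a \<otimes>\<^bsub>G\<^esub> y = b}"

lemma card_left_solutions_iso:
  assumes f: "f \<in> iso G G'" and a: "a \<in> carrier G" and b: "b \<in> carrier G"
    and G: "monoid G"
  shows "card (left_solutions G' (f a) (f b)) = card (left_solutions G a b)"
proof -
  interpret monoid G by fact
  have hom: "f (u \<otimes>\<^bsub>G\<^esub> v) = f u \<otimes>\<^bsub>G'\<^esub> f v" if "u \<in> carrier G" "v \<in> carrier G" for u v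
    using f that by (auto simp: iso_def hom_def)
  have inj: "inj_on f (carrier G)" and surj: "f ` carrier G = carrier G'"
    using f by (auto simp: iso_def bij_betw_def)
  have "a \<otimes>\<^bsub>G\<^esub> y = b \<longleftrightarrow> f a \<otimes>\<^bsub>G'\<^esub> f y = f b" if "y \<in> carrier G" for y
    using hom[OF a that] inj_on_eq_iff[OF inj, of "a \<otimes>\<^bsub>G\<^esub> y" b] a b that by auto
  then have "left_solutions G' (f a) (f b) = f ` left_solutions G a b"
    unfolding left_solutions_def surj[symmetric] by blast
  moreover have "inj_on f (left_solutions G a b)"
    using inj by (rule inj_on_subset) (auto simp: left_solutions_def)
  ultimately show ?thesis
    by (simp add: card_image)
qed

lemma iso_nat_pow:
  assumes f: "f \<in> iso G G'" and a: "a \<in> carrier G" and G: "monoid G" and G': "monoid G'"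
  shows "f (a [^]\<^bsub>G\<^esub> n) = f a [^]\<^bsub>G'\<^esub> (n::nat)"
proof -
  interpret G: monoid G by fact
  interpret G': monoid G' by fact
  have hom: "f (u \<otimes>\<^bsub>G\<^esub> v) = f u \<otimes>\<^bsub>G'\<^esub> f v" if "u \<in> carrier G" "v \<in> carrier G" for u v
    using f that by (auto simp: iso_def hom_def)
  \<comment> \<open>Without cancellation, surjectivity is what forces the identity to be preserved.\<close>
  obtain c where c: "c \<in> carrier G" "f c = \<one>\<^bsub>G'\<^esub>"
    using f G'.one_closed unfolding iso_iff by (metis imageE)
  have "f \<one>\<^bsub>G\<^esub> \<in> carrier G'"
    using f by (auto simp: iso_def hom_def)
  then have "f \<one>\<^bsub>G\<^esub> = \<one>\<^bsub>G'\<^esub>"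
    using hom[OF G.one_closed c(1)] c by simp
  then show ?thesis
    using a by (induction n) (simp_all add: hom)
qed

lemma (in monoid) inv_into_iso:
  assumes f: "f \<in> iso G G'"
  shows "inv_into (carrier G) f \<in> iso G' G"
proof -
  let ?h = "inv_into (carrier G) f"
  have bij: "bij_betw f (carrier G) (carrier G')"
    using f by (simp add: iso_def)
  then have bij': "bij_betw ?h (carrier G') (carrier G)"
    by (rule bij_betw_inv_into)
  have "?h (u \<otimes>\<^bsub>G'\<^esub> v) = ?h u \<otimes> ?h v" if "u \<in> carrier G'" "v \<in> carrier G'" for u v
  proof (rule inv_into_f_eq)
    have hu: "?h u \<in> carrier G" and hv: "?h v \<in> carrier G"
      using bij' that by (auto dest: bij_betwE)
    then show "?h u \<otimes> ?h v \<in> carrier G" by simp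
    show "f (?h u \<otimes> ?h v) = u \<otimes>\<^bsub>G'\<^esub> v"
      using f hu hv bij_betw_inv_into_right[OF bij] that by (simp add: iso_def hom_def)
  qed (use bij in \<open>simp add: bij_betw_def\<close>)
  with bij' show ?thesis
    by (auto simp: iso_def hom_def dest: bij_betwE)
qed

section \<open>Products and powers of finite sets containing the identity\<close>

lemma carrier_reduced_fin_power_monoid:
  "X \<in> carrier (reduced_fin_power_monoid H) \<longleftrightarrow>
    finite X \<and> X \<subseteq> carrier H \<and> \<one>\<^bsub>H\<^esub> \<in> X"
  by (simp add: reduced_fin_power_monoid_def)

lemma one_reduced_fin_power_monoid: "\<one>\<^bsub>reduced_fin_power_monoid H\<^esub> = {\<one>\<^bsub>H\<^esub>}"
  by (simp add: reduced_fin_power_monoid_def)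

lemma in_mult_reduced_fin_power_monoid:
  "z \<in> X \<otimes>\<^bsub>reduced_fin_power_monoid H\<^esub> Y \<longleftrightarrow> (\<exists>x\<in>X. \<exists>y\<in>Y. z = x \<otimes>\<^bsub>H\<^esub> y)"
  by (auto simp: reduced_fin_power_monoid_def set_mult_def)

context monoid
begin

abbreviation P where "P \<equiv> reduced_fin_power_monoid G"

lemma monoid_P: "monoid P"
  using monoid_axioms by (rule monoid_reduced_fin_power_monoid)

lemma left_factor_subset:
  assumes "X \<in> carrier P" "Y \<in> carrier P"
  shows "X \<subseteq> X \<otimes>\<^bsub>P\<^esub> Y"
proof
  fix x assume "x \<in> X"
  moreover from this have "x = x \<otimes> \<one>"
    using assms by (auto simp: carrier_reduced_fin_power_monoid)
  ultimately show "x \<in> X \<otimes>\<^bsub>P\<^esub> Y"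
    using assms unfolding in_mult_reduced_fin_power_monoid carrier_reduced_fin_power_monoid
    by blast
qed

lemma right_factor_subset:
  assumes "X \<in> carrier P" "Y \<in> carrier P"
  shows "Y \<subseteq> X \<otimes>\<^bsub>P\<^esub> Y"
proof
  fix y assume "y \<in> Y"
  moreover from this have "y = \<one> \<otimes> y"
    using assms by (auto simp: carrier_reduced_fin_power_monoid)
  ultimately show "y \<in> X \<otimes>\<^bsub>P\<^esub> Y"
    using assms unfolding in_mult_reduced_fin_power_monoid carrier_reduced_fin_power_monoid
    by blast
qed

lemma finite_left_solutions:
  assumes "X \<in> carrier P" "W \<in> carrier P"
  shows "finite (left_solutions P X W)"
proof (rule finite_subset)
  show "left_solutions P X W \<subseteq> Pow W"
    using right_factor_subset[OF assms(1)] by (auto simp: left_solutions_def)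
  show "finite (Pow W)"
    using assms(2) by (simp add: carrier_reduced_fin_power_monoid)
qed

text \<open>An idempotent \<open>E\<close> of \<open>P\<close> is a finite submonoid. A solution \<open>Y\<close> of \<open>E Y = E\<close> is contained
  in the product, hence in \<open>E\<close>; conversely \<open>E Y \<subseteq> E E = E\<close> whenever \<open>Y \<subseteq> E\<close>.\<close>

lemma card_absorbed_by_idempotent:
  assumes E: "E \<in> carrier P" and idem: "E \<otimes>\<^bsub>P\<^esub> E = E"
  shows "card (left_solutions P E E) = 2 ^ (card E - 1)"
proof -
  have "left_solutions P E E = insert \<one> ` Pow (E - {\<one>})"
  proof (intro equalityI subsetI)
    fix Y assume Y: "Y \<in> left_solutions P E E"
    then have "\<one> \<in> Y" "Y \<subseteq> E"
      using right_factor_subset[OF E, of Y]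
      by (auto simp: left_solutions_def carrier_reduced_fin_power_monoid)
    then show "Y \<in> insert \<one> ` Pow (E - {\<one>})"
      by (intro image_eqI[of _ _ "Y - {\<one>}"]) auto
  next
    fix Y assume "Y \<in> insert \<one> ` Pow (E - {\<one>})"
    then have "\<one> \<in> Y" "Y \<subseteq> E"
      using E by (auto simp: carrier_reduced_fin_power_monoid)
    then have Y: "Y \<in> carrier P"
      using E by (auto simp: carrier_reduced_fin_power_monoid intro: finite_subset)
    have "E \<otimes>\<^bsub>P\<^esub> Y \<subseteq> E \<otimes>\<^bsub>P\<^esub> E"
      using \<open>Y \<subseteq> E\<close> unfolding subset_iff in_mult_reduced_fin_power_monoid by blast
    then show "Y \<in> left_solutions P E E"
      using left_factor_subset[OF E Y] Y idem by (auto simp: left_solutions_def)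
  qed
  moreover have "inj_on (insert \<one>) (Pow (E - {\<one>}))"
    by (auto simp: inj_on_def)
  ultimately show ?thesis
    using E by (simp add: card_image card_Pow carrier_reduced_fin_power_monoid)
qed

lemma idempotent_pow_if_stationary:
  assumes X: "X \<in> carrier P" and stat: "X [^]\<^bsub>P\<^esub> Suc n = X [^]\<^bsub>P\<^esub> n"
  shows "X [^]\<^bsub>P\<^esub> n \<otimes>\<^bsub>P\<^esub> X [^]\<^bsub>P\<^esub> n = X [^]\<^bsub>P\<^esub> n"
proof -
  interpret P: monoid P by (rule monoid_P)
  have "X [^]\<^bsub>P\<^esub> (n + m) = X [^]\<^bsub>P\<^esub> n" for m
    using stat by (induction m) simp_all
  then show ?thesis
    using X by (simp add: P.nat_pow_mult)
qed

text \<open>The chain starts with \<open>X\<close> itself, and each of the \<open>n\<close> further steps contributes at least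
  one new element.\<close>

lemma card_pow_ge_if_not_stationary:
  assumes X: "X \<in> carrier P"
    and "\<And>i. i < Suc n \<Longrightarrow> X [^]\<^bsub>P\<^esub> Suc i \<noteq> X [^]\<^bsub>P\<^esub> i"
  shows "card X + n \<le> card (X [^]\<^bsub>P\<^esub> Suc n)"
  using assms(2)
proof (induction n)
  case 0
  interpret P: monoid P by (rule monoid_P)
  show ?case using X by simp
next
  case (Suc n)
  interpret P: monoid P by (rule monoid_P)
  let ?Y = "X [^]\<^bsub>P\<^esub> Suc n"
  have Y: "?Y \<in> carrier P" using X by (rule P.nat_pow_closed)
  have "?Y \<subseteq> X [^]\<^bsub>P\<^esub> Suc (Suc n)"
    using left_factor_subset[OF Y X] by simp
  moreover have "?Y \<noteq> X [^]\<^bsub>P\<^esub> Suc (Suc n)"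
    using Suc.prems[of "Suc n"] by auto
  moreover have "finite (X [^]\<^bsub>P\<^esub> Suc (Suc n))"
    using P.nat_pow_closed[OF X] carrier_reduced_fin_power_monoid by metis
  ultimately have "card ?Y < card (X [^]\<^bsub>P\<^esub> Suc (Suc n))"
    by (intro psubset_card_mono) auto
  moreover have "card X + n \<le> card ?Y"
    using Suc.prems by (intro Suc.IH) auto
  ultimately show ?case by linarith
qed

lemma pair_in_carrier: "x \<in> carrier G \<Longrightarrow> {\<one>, x} \<in> carrier P"
  by (simp add: carrier_reduced_fin_power_monoid)

lemma pow_pair:
  assumes x: "x \<in> carrier G"
  shows "{\<one>, x} [^]\<^bsub>P\<^esub> n = (\<lambda>i. x [^] i) ` {..n::nat}"
proof (induction n)
  case 0
  interpret P: monoid P by (rule monoid_P)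
  show ?case by (simp add: one_reduced_fin_power_monoid)
next
  case (Suc n)
  interpret P: monoid P by (rule monoid_P)
  have "{\<one>, x} [^]\<^bsub>P\<^esub> Suc n = (\<lambda>i. x [^] i) ` {..n} \<otimes>\<^bsub>P\<^esub> {\<one>, x}"
    by (simp add: Suc.IH)
  also have "\<dots> = (\<lambda>i. x [^] i) ` {..n} \<union> (\<lambda>i. x [^] Suc i) ` {..n}"
    using x by (auto simp: in_mult_reduced_fin_power_monoid)
  also have "\<dots> = (\<lambda>i. x [^] i) ` ({..n} \<union> Suc ` {..n})"
    by (auto simp: image_Un image_image)
  also have "{..n} \<union> Suc ` {..n} = {..Suc n}"
    by (auto simp: le_Suc_eq)
  finally show ?case .
qed

section \<open>The equation \<open>X Y = X\<^sup>3\<close>\<close>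

text \<open>Removing \<open>a \<in> X\<close> from \<open>X\<^sup>2\<close> loses nothing in \<open>X\<^sup>3\<close>: the element \<open>a = a 1\<close> comes from the
  left factor, and a product \<open>b a\<close> with \<open>b \<in> X\<close> lies in \<open>X\<^sup>2\<close>, hence either equals \<open>a\<close> or
  is still available in the right factor.\<close>

lemma square_minus_is_left_solution:
  assumes X: "X \<in> carrier P" and a: "a \<in> X" "a \<noteq> \<one>"
  shows "(X \<otimes>\<^bsub>P\<^esub> X) - {a} \<in> left_solutions P X (X \<otimes>\<^bsub>P\<^esub> (X \<otimes>\<^bsub>P\<^esub> X))"
proof -
  interpret P: monoid P by (rule monoid_P)
  let ?S = "X \<otimes>\<^bsub>P\<^esub> X"
  let ?Y = "?S - {a}"
  have S: "?S \<in> carrier P" using X by simp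
  then have Y: "?Y \<in> carrier P"
    using a by (auto simp: carrier_reduced_fin_power_monoid)
  have "X \<otimes>\<^bsub>P\<^esub> ?S \<subseteq> X \<otimes>\<^bsub>P\<^esub> ?Y"
  proof
    fix z assume "z \<in> X \<otimes>\<^bsub>P\<^esub> ?S"
    then obtain b s where b: "b \<in> X" and s: "s \<in> ?S" and z: "z = b \<otimes> s"
      by (auto simp: in_mult_reduced_fin_power_monoid)
    show "z \<in> X \<otimes>\<^bsub>P\<^esub> ?Y"
    proof (cases "s = a")
      case False
      with s have "s \<in> ?Y" by blast
      with b z show ?thesis unfolding in_mult_reduced_fin_power_monoid by blast
    next
      case True
      with a b z have "z \<in> ?S" by (auto simp: in_mult_reduced_fin_power_monoid)
      then show ?thesis
        using left_factor_subset[OF X Y] right_factor_subset[OF X Y] a by blast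
    qed
  qed
  moreover have "X \<otimes>\<^bsub>P\<^esub> ?Y \<subseteq> X \<otimes>\<^bsub>P\<^esub> ?S"
    unfolding subset_iff in_mult_reduced_fin_power_monoid[of _ _ X] by blast
  ultimately show ?thesis
    using Y by (auto simp: left_solutions_def)
qed

lemma card_le_card_left_solutions_cube:
  assumes X: "X \<in> carrier P"
  shows "card X \<le> card (left_solutions P X (X [^]\<^bsub>P\<^esub> (3::nat)))"
proof -
  interpret P: monoid P by (rule monoid_P)
  let ?S = "X \<otimes>\<^bsub>P\<^esub> X"
  have cube: "X [^]\<^bsub>P\<^esub> (3::nat) = X \<otimes>\<^bsub>P\<^esub> ?S"
    using X by (simp add: numeral_3_eq_3 P.m_assoc)
  \<comment> \<open>The identity indexes the solution \<open>X\<^sup>2\<close> itself, any other \<open>a\<close> the solution \<open>X\<^sup>2 - {a}\<close>.\<close>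
  define h where "h = (\<lambda>a. if a = \<one> then ?S else ?S - {a})"
  have sub: "X \<subseteq> ?S" using left_factor_subset[OF X X] .
  have "inj_on h X"
  proof (rule inj_onI)
    fix a b assume "a \<in> X" "b \<in> X" "h a = h b"
    with sub show "a = b" by (auto simp: h_def split: if_splits)
  qed
  moreover have "h ` X \<subseteq> left_solutions P X (X [^]\<^bsub>P\<^esub> (3::nat))"
    using square_minus_is_left_solution[OF X] X by (auto simp: h_def cube left_solutions_def)
  ultimately show ?thesis
    using X by (intro card_inj_on_le finite_left_solutions P.nat_pow_closed)
qed

text \<open>A solution \<open>Y\<close> is a subset of \<open>{1, x, x\<^sup>2, x\<^sup>3}\<close>. It omits \<open>x\<^sup>3\<close>, for otherwise \<open>x\<^sup>4\<close>
  would not be new in the fourth power; and it contains \<open>x\<^sup>2\<close>, for \<open>x\<^sup>3\<close> must be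
  \<open>x y\<close> with \<open>y \<in> Y\<close>, and \<open>y = 1\<close> or \<open>y = x\<close> would again turn \<open>x\<^sup>4\<close> into a lower power. Only the membership of \<open>x\<close> is free.\<close>

lemma left_solutions_cube_pair:
  assumes x: "x \<in> carrier G"
    and not_stat: "{\<one>, x} [^]\<^bsub>P\<^esub> (4::nat) \<noteq> {\<one>, x} [^]\<^bsub>P\<^esub> (3::nat)"
  shows "left_solutions P {\<one>, x} ({\<one>, x} [^]\<^bsub>P\<^esub> (3::nat))
    \<subseteq> {{\<one>, x \<otimes> x}, {\<one>, x, x \<otimes> x}}"
proof
  let ?X = "{\<one>, x}" and ?x2 = "x \<otimes> x"
  let ?x3 = "?x2 \<otimes> x"
  let ?x4 = "?x3 \<otimes> x"
  have cube: "?X [^]\<^bsub>P\<^esub> (3::nat) = {\<one>, x, ?x2, ?x3}"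
    unfolding pow_pair[OF x] using x by (auto simp: eval_nat_numeral atMost_Suc)
  have "?X [^]\<^bsub>P\<^esub> (4::nat) = {\<one>, x, ?x2, ?x3, ?x4}"
    unfolding pow_pair[OF x] using x by (auto simp: eval_nat_numeral atMost_Suc)
  with not_stat cube have x4: "?x4 \<notin> {\<one>, x, ?x2, ?x3}" by auto
  fix Y assume "Y \<in> left_solutions P ?X (?X [^]\<^bsub>P\<^esub> (3::nat))"
  then have Y: "Y \<in> carrier P" and XY: "?X \<otimes>\<^bsub>P\<^esub> Y = {\<one>, x, ?x2, ?x3}"
    by (auto simp: left_solutions_def cube)
  have one: "\<one> \<in> Y" using Y by (simp add: carrier_reduced_fin_power_monoid)
  have sub: "Y \<subseteq> {\<one>, x, ?x2, ?x3}"
    using right_factor_subset[OF pair_in_carrier[OF x] Y] XY by simp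
  have "?x3 \<notin> Y"
  proof
    assume "?x3 \<in> Y"
    then have "x \<otimes> ?x3 \<in> ?X \<otimes>\<^bsub>P\<^esub> Y" by (auto simp: in_mult_reduced_fin_power_monoid)
    moreover have "x \<otimes> ?x3 = ?x4" using x by (simp add: m_assoc)
    ultimately show False using x4 XY by simp
  qed
  moreover have "?x2 \<in> Y"
  proof -
    have "?x3 \<in> ?X \<otimes>\<^bsub>P\<^esub> Y" using XY by simp
    then obtain y where y: "y \<in> Y" "?x3 = y \<or> ?x3 = x \<otimes> y"
      using Y by (auto simp: in_mult_reduced_fin_power_monoid carrier_reduced_fin_power_monoid)
    with \<open>?x3 \<notin> Y\<close> have x3: "?x3 = x \<otimes> y" by auto
    have "y \<noteq> \<one>" "y \<noteq> x"
      using x3 x4 x by auto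
    with y sub \<open>?x3 \<notin> Y\<close> show ?thesis by auto
  qed
  ultimately show "Y \<in> {{\<one>, ?x2}, {\<one>, x, ?x2}}"
    using sub one by auto
qed

end

section \<open>Isomorphisms preserve pairs\<close>

text \<open>Both cases compare numbers of solutions. If the powers of \<open>X\<close> grow past the cube, the equation
  \<open>X Y = X\<^sup>3\<close> decides. Otherwise some power is idempotent, and its cardinality, which is preserved,
  leaves only one element for each step of the chain.\<close>

lemma card_iso_pair_le:
  assumes H: "monoid H" and K: "monoid K"
    and f: "f \<in> iso (reduced_fin_power_monoid H) (reduced_fin_power_monoid K)"
    and x: "x \<in> carrier H"
  shows "card (f {\<one>\<^bsub>H\<^esub>, x}) \<le> 2"
proof -
  interpret H: monoid H by fact
  interpret K: monoid K by fact
  interpret PH: monoid H.P by (rule H.monoid_P)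
  interpret PK: monoid K.P by (rule K.monoid_P)
  define X where "X = {\<one>\<^bsub>H\<^esub>, x}"
  have X: "X \<in> carrier H.P" using H.pair_in_carrier[OF x] by (simp add: X_def)
  have A: "f X \<in> carrier K.P" using f X by (auto simp: iso_def hom_def)
  have pow: "f X [^]\<^bsub>K.P\<^esub> n = f (X [^]\<^bsub>H.P\<^esub> n)" for n :: nat
    using iso_nat_pow[OF f X PH.monoid_axioms PK.monoid_axioms] by simp
  have inj: "inj_on f (carrier H.P)" using f by (auto simp: iso_def bij_betw_def)
  have pow_eq: "f X [^]\<^bsub>K.P\<^esub> m = f X [^]\<^bsub>K.P\<^esub> n \<longleftrightarrow> X [^]\<^bsub>H.P\<^esub> m = X [^]\<^bsub>H.P\<^esub> n" for m n :: nat
    using inj X by (simp add: pow inj_on_eq_iff)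
  show ?thesis
  proof (cases "X [^]\<^bsub>H.P\<^esub> (4::nat) = X [^]\<^bsub>H.P\<^esub> (3::nat)")
    case False
    have "card (f X) \<le> card (left_solutions K.P (f X) (f X [^]\<^bsub>K.P\<^esub> (3::nat)))"
      using A by (rule K.card_le_card_left_solutions_cube)
    also have "\<dots> = card (left_solutions H.P X (X [^]\<^bsub>H.P\<^esub> (3::nat)))"
      using card_left_solutions_iso[OF f X PH.nat_pow_closed[OF X] PH.monoid_axioms]
      by (simp add: pow)
    also have "\<dots> \<le> card {{\<one>\<^bsub>H\<^esub>, x \<otimes>\<^bsub>H\<^esub> x}, {\<one>\<^bsub>H\<^esub>, x, x \<otimes>\<^bsub>H\<^esub> x}}"
      using H.left_solutions_cube_pair[OF x] False by (intro card_mono) (auto simp: X_def)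
    also have "\<dots> \<le> 2" by (simp add: card_insert_if)
    finally show ?thesis by (simp add: X_def)
  next
    case True
    \<comment> \<open>The least stationary step is needed: only below it do the powers of \<open>f X\<close> grow strictly.\<close>
    let ?stat = "\<lambda>n::nat. X [^]\<^bsub>H.P\<^esub> Suc n = X [^]\<^bsub>H.P\<^esub> n"
    define n where "n = (LEAST n. ?stat n)"
    have "?stat 3" using True by (simp only: eval_nat_numeral BitM.simps)
    then have stat: "?stat n" unfolding n_def by (rule LeastI)
    have not_stat: "\<not> ?stat i" if "i < n" for i
      using that not_less_Least unfolding n_def by blast
    show ?thesis
    proof (cases n)
      case 0
      with stat have "f X [^]\<^bsub>K.P\<^esub> Suc 0 = f X [^]\<^bsub>K.P\<^esub> (0::nat)"
        unfolding pow_eq by simp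
      then have "f X = {\<one>\<^bsub>K\<^esub>}"
        using A by (simp add: one_reduced_fin_power_monoid[symmetric])
      then show ?thesis by (simp add: X_def)
    next
      case (Suc m)
      let ?E = "X [^]\<^bsub>H.P\<^esub> n" and ?F = "f X [^]\<^bsub>K.P\<^esub> n"
      have E: "?E \<in> carrier H.P" and F: "?F \<in> carrier K.P" using X A by simp_all
      have pos: "card ?E > 0" "card ?F > 0"
        using E F by (auto simp: carrier_reduced_fin_power_monoid card_gt_0_iff)
      have "(2::nat) ^ (card ?F - 1) = card (left_solutions K.P ?F ?F)"
        using K.card_absorbed_by_idempotent[OF F] K.idempotent_pow_if_stationary[OF A, of n]
          stat pow_eq[of "Suc n" n] by simp
      also have "\<dots> = card (left_solutions H.P ?E ?E)"
        using card_left_solutions_iso[OF f E E PH.monoid_axioms] by (simp add: pow)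
      also have "\<dots> = 2 ^ (card ?E - 1)"
        using H.card_absorbed_by_idempotent[OF E] H.idempotent_pow_if_stationary[OF X stat] by simp
      finally have "card ?F = card ?E"
        using pos by auto
      also have "\<dots> \<le> Suc n"
        using card_image_le[of "{..n}" "\<lambda>i. x [^]\<^bsub>H\<^esub> i"] H.pow_pair[OF x] by (simp add: X_def)
      finally have "card ?F \<le> Suc n" .
      moreover have "card (f X) + m \<le> card ?F"
        unfolding Suc
        by (rule K.card_pow_ge_if_not_stationary[OF A]) (use not_stat Suc pow_eq in blast)
      ultimately show ?thesis
        using Suc by (simp add: X_def)
    qed
  qed
qed

lemma iso_pair:
  assumes H: "monoid H" and K: "monoid K"
    and f: "f \<in> iso (reduced_fin_power_monoid H) (reduced_fin_power_monoid K)"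
    and x: "x \<in> carrier H"
  shows "\<exists>y\<in>carrier K. f {\<one>\<^bsub>H\<^esub>, x} = {\<one>\<^bsub>K\<^esub>, y}"
proof -
  let ?A = "f {\<one>\<^bsub>H\<^esub>, x}"
  have "?A \<in> carrier (reduced_fin_power_monoid K)"
    using f monoid.pair_in_carrier[OF H x] by (auto simp: iso_def hom_def)
  then have A: "finite ?A" "?A \<subseteq> carrier K" "\<one>\<^bsub>K\<^esub> \<in> ?A"
    by (simp_all add: carrier_reduced_fin_power_monoid)
  have "card (?A - {\<one>\<^bsub>K\<^esub>}) \<le> Suc 0"
    using card_iso_pair_le[OF H K f x] A by simp
  then consider "?A - {\<one>\<^bsub>K\<^esub>} = {}" | y where "?A - {\<one>\<^bsub>K\<^esub>} = {y}"
    using A by (metis card_1_singletonE card_0_eq finite_Diff le_SucE le_zero_eq One_nat_def)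
  then show ?thesis
  proof cases
    case 1
    with A show ?thesis by (intro bexI[of _ "\<one>\<^bsub>K\<^esub>"]) auto
  next
    case 2
    with A show ?thesis by (intro bexI[of _ y]) auto
  qed
qed

theorem corollary3p3:
  fixes H :: "('a, 'm) monoid_scheme" and K :: "('b, 'n) monoid_scheme"
    and f :: "'a set \<Rightarrow> 'b set"
  assumes "monoid H" and "monoid K"
    and "f \<in> iso (reduced_fin_power_monoid H) (reduced_fin_power_monoid K)"
  shows "\<exists>g. bij_betw g (carrier H) (carrier K)
    \<and> (\<forall>x \<in> carrier H. f {\<one>\<^bsub>H\<^esub>, x} = {\<one>\<^bsub>K\<^esub>, g x})
    \<and> g \<one>\<^bsub>H\<^esub> = \<one>\<^bsub>K\<^esub>
    \<and> (\<forall>g'. bij_betw g' (carrier H) (carrier K)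
          \<and> (\<forall>x \<in> carrier H. f {\<one>\<^bsub>H\<^esub>, x} = {\<one>\<^bsub>K\<^esub>, g' x})
        \<longrightarrow> (\<forall>x \<in> carrier H. g' x = g x))"
proof -
  interpret H: monoid H by fact
  interpret K: monoid K by fact
  note f = assms(3)
  have bij: "bij_betw f (carrier H.P) (carrier K.P)"
    using f by (simp add: iso_def)
  obtain g where g: "\<And>x. x \<in> carrier H \<Longrightarrow> g x \<in> carrier K"
    and fg: "\<And>x. x \<in> carrier H \<Longrightarrow> f {\<one>\<^bsub>H\<^esub>, x} = {\<one>\<^bsub>K\<^esub>, g x}"
    using iso_pair[OF assms] by metis
  have inj: "inj_on g (carrier H)"
  proof (rule inj_onI)
    fix x y assume xy: "x \<in> carrier H" "y \<in> carrier H" "g x = g y"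
    then have "f {\<one>\<^bsub>H\<^esub>, x} = f {\<one>\<^bsub>H\<^esub>, y}" by (simp add: fg)
    then have "{\<one>\<^bsub>H\<^esub>, x} = {\<one>\<^bsub>H\<^esub>, y}"
      using bij xy H.pair_in_carrier by (metis bij_betw_imp_inj_on inj_onD)
    then show "x = y" by (auto simp: doubleton_eq_iff)
  qed
  have surj: "\<exists>x\<in>carrier H. g x = y" if y: "y \<in> carrier K" for y
  proof -
    have "inv_into (carrier H.P) f \<in> iso K.P H.P"
      using monoid.inv_into_iso[OF H.monoid_P f] .
    then obtain x where x: "x \<in> carrier H"
      and "inv_into (carrier H.P) f {\<one>\<^bsub>K\<^esub>, y} = {\<one>\<^bsub>H\<^esub>, x}"
      using iso_pair[OF assms(2,1) _ y] by blast
    then have "f {\<one>\<^bsub>H\<^esub>, x} = {\<one>\<^bsub>K\<^esub>, y}"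
      using bij_betw_inv_into_right[OF bij K.pair_in_carrier[OF y]] by simp
    with fg[OF x] x show ?thesis by (auto simp: doubleton_eq_iff)
  qed
  have "f {\<one>\<^bsub>H\<^esub>} = {\<one>\<^bsub>K\<^esub>}"
    using iso_nat_pow[OF f H.pair_in_carrier[OF H.one_closed] H.monoid_P K.monoid_P, of 0]
    by (simp add: one_reduced_fin_power_monoid)
  then have "g \<one>\<^bsub>H\<^esub> = \<one>\<^bsub>K\<^esub>"
    using fg[OF H.one_closed] by auto
  moreover have "bij_betw g (carrier H) (carrier K)"
    using inj surj g by (auto simp: bij_betw_def)
  moreover have "g' x = g x"
    if "\<forall>x \<in> carrier H. f {\<one>\<^bsub>H\<^esub>, x} = {\<one>\<^bsub>K\<^esub>, g' x}" and x: "x \<in> carrier H" for g' x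
  proof -
    have "{\<one>\<^bsub>K\<^esub>, g' x} = {\<one>\<^bsub>K\<^esub>, g x}" using that fg[OF x] by simp
    then show ?thesis by (auto simp: doubleton_eq_iff)
  qed
  ultimately show ?thesis
    using fg by blast
qed

end
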